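(* Let $\alpha,\beta\in\mathbb{C}$ with $2\alpha+\beta\notin\{0,-1,-2,\dots\}$. Then $$F_1\!\left(3\alpha;\,2\beta-1,\,2\alpha+1-2\beta;\,2\alpha+\beta;\,\tfrac34,\tfrac14\right)=\frac{2^{4\alpha+1}\,\pi\;\Gamma(2\alpha+\beta)}{3^{3\alpha+1/2}\,\Gamma(\alpha+\tfrac13)\,\Gamma(\alpha+\tfrac23)\,\Gamma(\beta)}.$$
   Context: $F_1$ is the Appell hypergeometric series $$F_1(a;b_1,b_2;c;x,y):=\sum_{m=0}^{\infty}\sum_{n=0}^{\infty}\frac{(a,m+n)(b_1,m)(b_2,n)}{(c,m+n)(1,m)(1,n)}x^my^n,\qquad (\alpha,n):=\Gamma(\alpha+n)/\Gamma(\alpha)$$ (so $(\alpha,n)=\alpha(\alpha+1)\cdots(\alpha+n-1)$ for $n\ge 0$). $1/\Gamma$ is interpreted as $0$ at the poles of $\Gamma$. *)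

theory Defs
  imports "HOL-Analysis.Analysis"
begin

(* (1,m) and (1,n) are the factorials; pochhammer \<alpha> n is the finite product form of
   Gamma (\<alpha> + n) / Gamma \<alpha>, hence also meaningful at the poles of Gamma. *)
definition appell_F1 ::
  "complex \<Rightarrow> complex \<Rightarrow> complex \<Rightarrow> complex \<Rightarrow> complex \<Rightarrow> complex \<Rightarrow> complex" where
  "appell_F1 a b1 b2 c x y =
     (\<Sum>m. \<Sum>n. pochhammer a (m + n) * pochhammer b1 m * pochhammer b2 n
              / (pochhammer c (m + n) * pochhammer 1 m * pochhammer 1 n) * x ^ m * y ^ n)"

end

theory Submission
  imports Defs "HOL-Complex_Analysis.Conformal_Mappings" "HOL-Real_Asymp.Real_Asymp"
begin

text \<open>
  The identity is a Beta integral in disguise.  Euler's integral represents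
  \<open>F\<^sub>1(3\<alpha>; 2\<beta> - 1, 2\<alpha> + 1 - 2\<beta>; 2\<alpha> + \<beta>; 3/4, 1/4)\<close> as a constant times the integral over \<open>[0,1]\<close> of
  \<open>t\<close> to the power \<open>3\<alpha> - 1\<close>, times \<open>1 - t\<close> to the power \<open>\<beta> - \<alpha> - 1\<close>, times
  \<open>1 - 3t/4\<close> to the power \<open>1 - 2\<beta>\<close>, times \<open>1 - t/4\<close> to the power \<open>2\<beta> - 2\<alpha> - 1\<close>.
  The arguments \<open>3/4\<close> and \<open>1/4\<close> are special because the cubic map
  \<open>s = t^3 / (4 - 3t)^2\<close> of \<open>[0,1]\<close> onto itself satisfies
  \<open>1 - s = (1 - t) (4 - t)^2 / (4 - 3t)^2\<close> and \<open>ds/dt = 3 t^2 (4 - t) / (4 - 3t)^3\<close>: everything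
  factors through the four linear forms of the integrand, and the exponents are such that the
  integral becomes a multiple of \<open>B(\<alpha>, \<beta> - \<alpha>)\<close> (\<open>cubic_substitution_integral\<close>).
  Gauss' multiplication formula for \<open>\<Gamma>(3\<alpha>)\<close> turns the resulting Gamma quotient
  into the stated one.

  The integral converges only for restricted parameters, so the argument is carried out for real
  \<open>\<alpha> > 1\<close> and \<open>\<beta> > \<alpha> + 1\<close>, where the integrands are continuous up to the
  endpoints.  The general case follows by analytic continuation.  To have no poles to avoid,
  \<open>F\<^sub>1\<close> is divided by \<open>\<Gamma>(c)\<close>; the quotient \<open>appell_F1_reg\<close> is entire in
  the parameters by a locally uniform majorant, and the identity theorem is applied first in
  \<open>\<beta>\<close> and then in \<open>\<alpha>\<close>.
\<close>

section \<open>The regularised Appell series\<close>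

lemma pochhammer_ge_0: "0 \<le> R \<Longrightarrow> 0 \<le> pochhammer R n" for R :: real
  by (induction n) (simp_all add: pochhammer_Suc)

lemma norm_pochhammer_le:
  fixes b :: "'a :: real_normed_field"
  assumes "norm b \<le> R"
  shows "norm (pochhammer b n) \<le> pochhammer R n"
proof (induction n)
  case (Suc n)
  have "norm (b + of_nat n) \<le> R + real n"
    using norm_triangle_ineq[of b "of_nat n"] assms by simp
  moreover have "0 \<le> pochhammer R n"
    using Suc norm_ge_zero order_trans by blast
  ultimately show ?case
    using Suc by (simp add: pochhammer_Suc norm_mult mult_mono)
qed simp

text \<open>
  These are the Taylor coefficients of \<open>(1 - x t)^(-b1) (1 - y t)^(-b2)\<close> in \<open>t\<close>.
\<close>
definition binomial_prod_coeff :: "'a \<Rightarrow> 'a \<Rightarrow> 'a \<Rightarrow> 'a \<Rightarrow> nat \<Rightarrow> 'a :: real_normed_field" where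
  "binomial_prod_coeff b1 b2 x y N =
     (\<Sum>k\<le>N. (pochhammer b1 k / fact k * x ^ k) *
             (pochhammer b2 (N - k) / fact (N - k) * y ^ (N - k)))"

text \<open>
  The factor \<open>1 / (c)\<^sub>N\<close> of the Appell series is replaced by \<open>1 / \<Gamma>(c + N)\<close>, that is,
  the series is divided by \<open>\<Gamma>(c)\<close>. This removes the poles in \<open>c\<close>.
\<close>
definition appell_F1_reg_term :: "'a \<Rightarrow> 'a \<Rightarrow> 'a \<Rightarrow> 'a \<Rightarrow> 'a \<Rightarrow> 'a \<Rightarrow> nat \<Rightarrow> nat \<Rightarrow> 'a :: Gamma" where
  "appell_F1_reg_term a b1 b2 c x y m n = pochhammer a (m + n) * rGamma (c + of_nat (m + n)) *
     ((pochhammer b1 m / fact m * x ^ m) * (pochhammer b2 n / fact n * y ^ n))"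

text \<open>
  Summing along the diagonals \<open>m + n = N\<close> makes the series a single one, whose terms are
  Taylor coefficients of a product of two binomials multiplied by a factor depending on \<open>N\<close> only.
\<close>
definition appell_F1_reg :: "'a \<Rightarrow> 'a \<Rightarrow> 'a \<Rightarrow> 'a \<Rightarrow> 'a \<Rightarrow> 'a \<Rightarrow> 'a :: Gamma" where
  "appell_F1_reg a b1 b2 c x y =
     (\<Sum>N. \<Sum>k\<le>N. appell_F1_reg_term a b1 b2 c x y k (N - k))"

lemma sum_appell_F1_reg_term:
  "(\<Sum>k\<le>N. appell_F1_reg_term a b1 b2 c x y k (N - k)) =
     pochhammer a N * rGamma (c + of_nat N) * binomial_prod_coeff b1 b2 x y N"
  by (simp add: appell_F1_reg_term_def binomial_prod_coeff_def sum_distrib_left)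

text \<open>
  A bound, up to a constant factor, for the \<open>N\<close>-th diagonal of the regularised series when all
  parameters have norm at most \<open>R\<close> and both arguments have norm at most \<open>q\<close>.
  The subtraction in \<open>N - Suc R\<close> is the truncated one: only from the index \<open>Suc R\<close> on
  is \<open>c + N\<close> known to stay away from the poles of \<open>\<Gamma>\<close>.
\<close>
definition majorant :: "nat \<Rightarrow> real \<Rightarrow> nat \<Rightarrow> real" where
  "majorant R q N = pochhammer (real R) N / fact (N - Suc R) *
     (pochhammer (2 * real R) N / fact N * q ^ N)"

text \<open>
  Replacing every parameter by \<open>R\<close> and every argument by \<open>q\<close> gives the coefficients of
  \<open>(1 - q t)^(-R) (1 - q t)^(-R) = (1 - q t)^(-2R)\<close>; on coefficients this is the
  Chu--Vandermonde identity.
\<close>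
lemma norm_binomial_terms_le:
  fixes b1 b2 x y :: "'a :: real_normed_field"
  assumes "norm b1 \<le> R" "norm b2 \<le> R" "norm x \<le> q" "norm y \<le> q"
  shows "(\<Sum>k\<le>N. norm ((pochhammer b1 k / fact k * x ^ k) *
             (pochhammer b2 (N - k) / fact (N - k) * y ^ (N - k))))
         \<le> pochhammer (2 * R) N / fact N * q ^ N"
proof -
  have R: "0 \<le> R" and q: "0 \<le> q"
    using assms(1,3) norm_ge_zero order_trans by blast+
  have P: "0 \<le> pochhammer R k" for k
    using R by (rule pochhammer_ge_0)
  have "(\<Sum>k\<le>N. norm ((pochhammer b1 k / fact k * x ^ k) *
             (pochhammer b2 (N - k) / fact (N - k) * y ^ (N - k))))
      \<le> (\<Sum>k\<le>N. (pochhammer R k / fact k * q ^ k) *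
             (pochhammer R (N - k) / fact (N - k) * q ^ (N - k)))"
    unfolding norm_mult norm_divide norm_power norm_fact using assms q P
    by (intro sum_mono mult_mono divide_right_mono power_mono norm_pochhammer_le)
      (auto intro!: mult_nonneg_nonneg)
  also have "\<dots> = (\<Sum>k\<le>N. real (N choose k) * pochhammer R k * pochhammer R (N - k)) / fact N * q ^ N"
    unfolding sum_divide_distrib sum_distrib_right
  proof (intro sum.cong refl)
    fix k assume "k \<in> {..N}"
    then have k: "k \<le> N" by simp
    have "q ^ N = q ^ (k + (N - k))" using k by simp
    also have "\<dots> = q ^ k * q ^ (N - k)" by (rule power_add)
    finally have qN: "q ^ N = q ^ k * q ^ (N - k)" .
    show "(pochhammer R k / fact k * q ^ k) * (pochhammer R (N - k) / fact (N - k) * q ^ (N - k))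
        = real (N choose k) * pochhammer R k * pochhammer R (N - k) / fact N * q ^ N"
      unfolding qN binomial_fact[OF k] by simp
  qed
  also have "\<dots> = pochhammer (2 * R) N / fact N * q ^ N"
    unfolding mult_2 pochhammer_binomial_sum ..
  finally show ?thesis .
qed

lemma norm_binomial_prod_coeff_le:
  fixes b1 b2 x y :: "'a :: real_normed_field"
  assumes "norm b1 \<le> R" "norm b2 \<le> R" "norm x \<le> q" "norm y \<le> q"
  shows "norm (binomial_prod_coeff b1 b2 x y N) \<le> pochhammer (2 * R) N / fact N * q ^ N"
  unfolding binomial_prod_coeff_def
  by (rule order_trans[OF norm_sum norm_binomial_terms_le[OF assms]])

lemma summable_binomial_majorant:
  assumes "0 < R" "0 < q" "q < 1"
  shows "summable (\<lambda>N. pochhammer R N / fact N * q ^ N :: real)"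
proof -
  define f where "f = (\<lambda>N. pochhammer R N / fact N * q ^ N :: real)"
  have pos: "f N > 0" for N
    unfolding f_def using assms by (auto intro!: mult_pos_pos divide_pos_pos pochhammer_pos)
  have "((\<lambda>N::nat. (R + real N) / (real N + 1) * q) \<longlongrightarrow> q) at_top"
    using assms by real_asymp
  then have "eventually (\<lambda>N::nat. (R + real N) / (real N + 1) * q < (1 + q) / 2) at_top"
    by (rule order_tendstoD) (use assms in auto)
  then obtain N0 where N0: "\<forall>N\<ge>N0. (R + real N) / (real N + 1) * q < (1 + q) / 2"
    unfolding eventually_at_top_linorder by (rule exE)
  have "summable f"
  proof (rule summable_ratio_test)
    show "(1 + q) / 2 < 1" using assms by simp
    fix N assume "N0 \<le> N"
    have "f (Suc N) = ((R + real N) / (real N + 1) * q) * f N"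
      by (simp add: f_def pochhammer_Suc field_simps)
    also have "\<dots> \<le> (1 + q) / 2 * f N"
      using N0 \<open>N0 \<le> N\<close> pos[of N] by (intro mult_right_mono less_imp_le[OF N0[rule_format]]) auto
    finally show "norm (f (Suc N)) \<le> (1 + q) / 2 * norm (f N)"
      using pos[of N] pos[of "Suc N"] by simp
  qed
  then show ?thesis unfolding f_def .
qed

lemma summable_majorant:
  assumes "0 < R" "0 < q" "q < 1"
  shows "summable (majorant R q)"
proof -
  define ratio where
    "ratio = (\<lambda>N::nat. (real R + N) / (N - real R) * ((2 * real R + N) / (N + 1) * q))"
  have pos: "majorant R q N > 0" for N
    unfolding majorant_def using assms
    by (auto intro!: mult_pos_pos divide_pos_pos pochhammer_pos)
  have "(ratio \<longlongrightarrow> q) at_top"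
    unfolding ratio_def using assms by real_asymp
  then have "eventually (\<lambda>N. ratio N < (1 + q) / 2) at_top"
    by (rule order_tendstoD) (use assms in auto)
  then have "eventually (\<lambda>N. ratio N < (1 + q) / 2 \<and> N > R) at_top"
    by (intro eventually_conj eventually_gt_at_top)
  then obtain N0 where N0: "\<And>N. N \<ge> N0 \<Longrightarrow> ratio N < (1 + q) / 2" "\<And>N. N \<ge> N0 \<Longrightarrow> N > R"
    by (auto simp: eventually_at_top_linorder)
  show ?thesis
  proof (rule summable_ratio_test)
    show "(1 + q) / 2 < 1" using assms by simp
    fix N assume "N0 \<le> N"
    with N0 have "R < N" by blast
    then obtain d where d: "N = Suc (R + d)" using less_iff_Suc_add by blast
    have "majorant R q (Suc N) = ratio N * majorant R q N"
      by (simp add: majorant_def ratio_def pochhammer_Suc d Suc_diff_le field_simps)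
    also have "\<dots> \<le> (1 + q) / 2 * majorant R q N"
      using N0(1)[OF \<open>N0 \<le> N\<close>] pos[of N] by (intro mult_right_mono) auto
    finally show "norm (majorant R q (Suc N)) \<le> (1 + q) / 2 * norm (majorant R q N)"
      using pos[of N] pos[of "Suc N"] by simp
  qed
qed

text \<open>
  Uniform factorial decay of \<open>1 / \<Gamma>(c + N)\<close> for \<open>c\<close> in a ball: with
  \<open>w = c + R + 1\<close> the functional equation gives \<open>1 / \<Gamma>(w + d) = 1 / (\<Gamma>(w) (w)\<^sub>d)\<close>, where
  \<open>1 / \<Gamma>\<close> is bounded on a compact set and \<open>|w + j| \<ge> j + 1\<close>.
\<close>
lemma norm_rGamma_add_of_nat_le:
  obtains M where "M \<ge> 0"
    "\<And>(c :: complex) N. norm c \<le> real R \<Longrightarrow> norm (rGamma (c + of_nat N)) \<le> M / fact (N - Suc R)"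
proof -
  have "compact (rGamma ` cball (0 :: complex) (2 * real R + 1))"
    by (intro compact_continuous_image holomorphic_on_imp_continuous_on holomorphic_rGamma compact_cball)
  then obtain M where M: "\<And>w :: complex. norm w \<le> 2 * real R + 1 \<Longrightarrow> norm (rGamma w) \<le> M"
    unfolding bounded_iff[symmetric] by (fastforce dest: compact_imp_bounded simp: bounded_iff)
  have M0: "M \<ge> 0"
    using M[of 0] by simp
  have "norm (rGamma (c + of_nat N)) \<le> M / fact (N - Suc R)" if c: "norm c \<le> real R" for c :: complex and N
  proof (cases "N \<le> Suc R")
    case True
    have "norm (c + of_nat N) \<le> 2 * real R + 1"
      using norm_triangle_ineq[of c "of_nat N"] c True by simp
    then show ?thesis using M True by simp
  next
    case False
    define d where "d = N - Suc R"
    define w where "w = c + of_nat (Suc R)"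
    have N: "c + of_nat N = w + of_nat d"
      using False by (simp add: w_def d_def of_nat_diff)
    have "norm w \<le> 2 * real R + 1"
      unfolding w_def using norm_triangle_ineq[of c "of_nat (Suc R)"] c
      by (simp only: norm_of_nat)
    then have wM: "norm (rGamma w) \<le> M" by (rule M)
    have P: "fact k \<le> norm (pochhammer w k)" for k
    proof (induction k)
      case (Suc k)
      have "w + of_nat k = of_nat (Suc R + k) + c" by (simp add: w_def)
      then have "real (Suc R + k) - norm c \<le> norm (w + of_nat k)"
        using norm_diff_ineq[of "of_nat (Suc R + k)" c] by (simp only: norm_of_nat)
      then have "real (Suc k) \<le> norm (w + of_nat k)" using c by simp
      then have "real (Suc k) * fact k \<le> norm (w + of_nat k) * norm (pochhammer w k)"
        using Suc by (intro mult_mono) auto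
      then show ?case by (simp add: pochhammer_Suc norm_mult mult.commute)
    qed simp
    have "fact d * norm (rGamma (w + of_nat d)) \<le> norm (pochhammer w d) * norm (rGamma (w + of_nat d))"
      using P by (intro mult_right_mono) auto
    also have "\<dots> = norm (rGamma w)"
      by (simp add: pochhammer_rGamma[of w d] norm_mult)
    finally show ?thesis
      using wM N by (simp add: d_def[symmetric] field_simps)
  qed
  with M0 show ?thesis by (rule that)
qed

lemma norm_appell_F1_reg_terms_le:
  assumes "norm x \<le> q" "norm y \<le> q"
  obtains M where
    "\<And>(a :: complex) b1 b2 c N.
       norm a \<le> real R \<Longrightarrow> norm b1 \<le> real R \<Longrightarrow> norm b2 \<le> real R \<Longrightarrow> norm c \<le> real R \<Longrightarrow>
       (\<Sum>k\<le>N. norm (appell_F1_reg_term a b1 b2 c x y k (N - k))) \<le> M * majorant R q N"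
proof -
  obtain M where M: "M \<ge> 0"
    "\<And>(c :: complex) N. norm c \<le> real R \<Longrightarrow> norm (rGamma (c + of_nat N)) \<le> M / fact (N - Suc R)"
    using norm_rGamma_add_of_nat_le[of R] by blast
  show ?thesis
  proof (rule that)
    fix a b1 b2 c :: complex and N
    assume *: "norm a \<le> real R" "norm b1 \<le> real R" "norm b2 \<le> real R" "norm c \<le> real R"
    have "(\<Sum>k\<le>N. norm (appell_F1_reg_term a b1 b2 c x y k (N - k)))
        = norm (pochhammer a N) * norm (rGamma (c + of_nat N)) *
          (\<Sum>k\<le>N. norm ((pochhammer b1 k / fact k * x ^ k) *
             (pochhammer b2 (N - k) / fact (N - k) * y ^ (N - k))))"
      unfolding sum_distrib_left
      by (intro sum.cong refl) (simp only: appell_F1_reg_term_def le_add_diff_inverse atMost_iff norm_mult mult.assoc)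
    also have "\<dots> \<le> pochhammer (real R) N * (M / fact (N - Suc R)) *
        (pochhammer (2 * real R) N / fact N * q ^ N)"
      using * assms M
      by (intro mult_mono norm_pochhammer_le norm_binomial_terms_le mult_nonneg_nonneg sum_nonneg
          pochhammer_ge_0 divide_nonneg_nonneg) auto
    also have "\<dots> = M * majorant R q N"
      by (simp add: majorant_def)
    finally show "(\<Sum>k\<le>N. norm (appell_F1_reg_term a b1 b2 c x y k (N - k))) \<le> M * majorant R q N" .
  qed
qed

text \<open>
  Both sides are the unconditional sum over all pairs \<open>(m, n)\<close>, which exists because the
  hypothesis is absolute summability along the diagonals.
\<close>
lemma suminf_suminf_diagonal:
  fixes f :: "nat \<Rightarrow> nat \<Rightarrow> 'a :: banach"
  assumes "summable (\<lambda>N. \<Sum>k\<le>N. norm (f k (N - k)))"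
  shows "(\<Sum>m. \<Sum>n. f m n) = (\<Sum>N. \<Sum>k\<le>N. f k (N - k))"
proof -
  define h where "h = (\<lambda>(N::nat, k::nat). (k, N - k))"
  define F where "F = (\<lambda>(m, n). f m n)"
  have bij: "bij_betw h (Sigma UNIV (\<lambda>N. {..N})) (UNIV \<times> UNIV)"
    by (rule bij_betwI[where g = "\<lambda>(m, n). (m + n, m)"]) (auto simp: h_def)
  have "(\<lambda>z. norm (F (h z))) summable_on Sigma UNIV (\<lambda>N. {..N})"
    unfolding Infinite_Sum.abs_summable_on_Sigma_iff[of "\<lambda>z. F (h z)"]
  proof (intro conjI ballI)
    have "summable (\<lambda>N. norm (norm (\<Sum>k\<le>N. norm (f k (N - k)))))"
      using assms by (simp add: sum_nonneg)
    then show "(\<lambda>N. norm (\<Sum>\<^sub>\<infinity>k\<in>{..N}. norm (F (h (N, k))))) summable_on UNIV"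
      by (intro norm_summable_imp_summable_on) (simp add: F_def h_def sum_nonneg)
  qed simp
  then have S1: "(\<lambda>z. F (h z)) summable_on Sigma UNIV (\<lambda>N. {..N})"
    by (rule abs_summable_summable)
  then have S2: "F summable_on UNIV \<times> UNIV"
    using summable_on_reindex_bij_betw[OF bij] by blast
  have S2': "(\<lambda>n. F (m, n)) summable_on UNIV" for m
  proof -
    have "F summable_on (Pair m ` UNIV)"
      by (rule summable_on_subset_banach[OF S2]) auto
    then show ?thesis
      by (subst (asm) summable_on_reindex) (auto simp: o_def inj_on_def)
  qed
  have S3: "(\<lambda>m. \<Sum>\<^sub>\<infinity>n. F (m, n)) summable_on UNIV"
    using summable_on_Sigma_banach[of "\<lambda>m n. F (m, n)" UNIV "\<lambda>_. UNIV"] S2 by simp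
  have S4: "(\<lambda>N. \<Sum>\<^sub>\<infinity>k\<in>{..N}. F (h (N, k))) summable_on UNIV"
    using summable_on_Sigma_banach[of "\<lambda>N k. F (h (N, k))" UNIV "\<lambda>N. {..N}"] S1
    by (simp add: cond_case_prod_eta)
  have suminf: "suminf g = infsum g UNIV" if "g summable_on UNIV" for g :: "nat \<Rightarrow> 'a"
    using has_sum_imp_sums[OF has_sum_infsum[OF that]] by (simp add: sums_iff)
  have "(\<Sum>m. \<Sum>n. f m n) = (\<Sum>\<^sub>\<infinity>m. \<Sum>\<^sub>\<infinity>n. F (m, n))"
    using suminf[OF S2'] suminf[OF S3] by (simp add: F_def)
  also have "\<dots> = infsum F (UNIV \<times> UNIV)"
    by (rule infsum_Sigma_banach[OF S2])
  also have "\<dots> = infsum (\<lambda>z. F (h z)) (Sigma UNIV (\<lambda>N. {..N}))"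
    by (rule infsum_reindex_bij_betw[OF bij, symmetric])
  also have "\<dots> = (\<Sum>\<^sub>\<infinity>N. \<Sum>\<^sub>\<infinity>k\<in>{..N}. F (h (N, k)))"
    by (rule infsum_Sigma_banach[OF S1, symmetric])
  also have "\<dots> = (\<Sum>N. \<Sum>k\<le>N. f k (N - k))"
    using suminf[OF S4] by (simp add: F_def h_def)
  finally show ?thesis .
qed

lemma appell_F1_eq_Gamma_times_reg:
  assumes c: "c \<notin> \<int>\<^sub>\<le>\<^sub>0" and x: "norm x < 1" and y: "norm y < 1"
  shows "appell_F1 a b1 b2 c x y = Gamma c * appell_F1_reg a b1 b2 c x y"
proof -
  \<comment> \<open>The maximum with \<open>1/2\<close> keeps \<open>q\<close> positive when both arguments vanish.\<close>
  define q where "q = max (1 / 2) (max (norm x) (norm y))"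
  have q: "0 < q" "q < 1" "norm x \<le> q" "norm y \<le> q" using x y by (auto simp: q_def)
  define R where "R = Suc (nat \<lceil>norm a + norm b1 + norm b2 + norm c\<rceil>)"
  have R': "norm a + norm b1 + norm b2 + norm c \<le> real R"
    unfolding R_def by linarith
  have R: "0 < R" "norm a \<le> real R" "norm b1 \<le> real R" "norm b2 \<le> real R" "norm c \<le> real R"
    using R' norm_ge_zero[of a] norm_ge_zero[of b1] norm_ge_zero[of b2] norm_ge_zero[of c]
    by (simp_all add: R_def del: norm_ge_zero)
  define t where "t = appell_F1_reg_term a b1 b2 c x y"
  obtain M where M: "\<And>N. (\<Sum>k\<le>N. norm (t k (N - k))) \<le> M * majorant R q N"
    unfolding t_def using norm_appell_F1_reg_terms_le[OF q(3,4), of R] R(2-5) by metis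
  have sm: "summable (\<lambda>N. \<Sum>k\<le>N. norm (t k (N - k)))"
    by (rule summable_comparison_test'[OF summable_mult[OF summable_majorant[OF R(1) q(1,2)], of M], of 0])
      (use M in \<open>auto simp: sum_nonneg\<close>)
  have sm': "summable (\<lambda>N. \<Sum>k\<le>N. t k (N - k))"
    by (rule summable_norm_cancel, rule summable_comparison_test'[OF sm, of 0]) (auto intro: norm_sum)
  have P: "1 / pochhammer c N = Gamma c * rGamma (c + of_nat N)" for N
  proof -
    have "pochhammer c N \<noteq> 0" using c by (auto dest: pochhammer_eq_0_imp_nonpos_Int)
    moreover have "Gamma c * rGamma c = 1"
      using c by (simp add: rGamma_inverse_Gamma Gamma_eq_zero_iff)
    ultimately show ?thesis
      using pochhammer_rGamma[of c N] by (simp add: field_simps)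
  qed
  have T: "pochhammer a (m + n) * pochhammer b1 m * pochhammer b2 n
              / (pochhammer c (m + n) * pochhammer 1 m * pochhammer 1 n) * x ^ m * y ^ n
      = Gamma c * t m n" for m n
  proof -
    have "pochhammer a (m + n) * pochhammer b1 m * pochhammer b2 n
              / (pochhammer c (m + n) * pochhammer 1 m * pochhammer 1 n) * x ^ m * y ^ n
      = (1 / pochhammer c (m + n)) * (pochhammer a (m + n) *
       ((pochhammer b1 m / fact m * x ^ m) * (pochhammer b2 n / fact n * y ^ n)))"
      by (simp only: mult_ac pochhammer_fact times_divide_eq_left times_divide_eq_right divide_divide_eq_left mult_1_left)
    then show ?thesis unfolding P t_def appell_F1_reg_term_def by (simp add: mult_ac)
  qed
  have "appell_F1 a b1 b2 c x y = (\<Sum>m. \<Sum>n. Gamma c * t m n)"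
    unfolding appell_F1_def T ..
  also have "\<dots> = (\<Sum>N. \<Sum>k\<le>N. Gamma c * t k (N - k))"
    by (rule suminf_suminf_diagonal)
      (use summable_mult[OF sm, of "norm (Gamma c)"] in \<open>simp add: norm_mult sum_distrib_left\<close>)
  also have "\<dots> = Gamma c * (\<Sum>N. \<Sum>k\<le>N. t k (N - k))"
    using suminf_mult[OF sm'] by (simp add: sum_distrib_left)
  also have "(\<Sum>N. \<Sum>k\<le>N. t k (N - k)) = appell_F1_reg a b1 b2 c x y"
    by (simp add: appell_F1_reg_def t_def)
  finally show ?thesis .
qed

text \<open>
  On a closed unit ball around any point the four parameters are bounded, so the partial sums
  converge uniformly there by the M-test.
\<close>
lemma holomorphic_appell_F1_reg:
  assumes hol: "a holomorphic_on UNIV" "b1 holomorphic_on UNIV" "b2 holomorphic_on UNIV"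
      "c holomorphic_on UNIV"
    and x: "norm x < 1" and y: "norm y < 1"
  shows "(\<lambda>z. appell_F1_reg (a z) (b1 z) (b2 z) (c z) x y) holomorphic_on UNIV"
proof -
  define q where "q = max (1 / 2) (max (norm x) (norm y))"
  have q: "0 < q" "q < 1" "norm x \<le> q" "norm y \<le> q" using x y by (auto simp: q_def)
  define T where "T = (\<lambda>N z. \<Sum>k\<le>N. appell_F1_reg_term (a z) (b1 z) (b2 z) (c z) x y k (N - k))"
  have poch: "(\<lambda>z. pochhammer (g z) N) holomorphic_on UNIV" if "g holomorphic_on UNIV" for g N
    using that unfolding pochhammer_prod by (intro holomorphic_intros)
  have holT: "T N holomorphic_on UNIV" for N
    unfolding T_def appell_F1_reg_term_def divide_inverse
    by (intro holomorphic_on_sum holomorphic_on_mult holomorphic_on_const poch hol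
        holomorphic_rGamma' holomorphic_on_add)
  show ?thesis
  proof (rule holomorphic_uniform_sequence[where f = "\<lambda>n z. \<Sum>N<n. T N z"])
    show "(\<lambda>z. \<Sum>N<n. T N z) holomorphic_on UNIV" for n
      by (intro holomorphic_on_sum holT)
    fix z0 :: complex
    have "\<exists>B. \<forall>z\<in>cball z0 1. norm (g z) \<le> B" if "g holomorphic_on UNIV" for g
    proof -
      have "compact (g ` cball z0 1)"
        using that by (intro compact_continuous_image holomorphic_on_imp_continuous_on compact_cball)
          (auto intro: holomorphic_on_subset)
      then show ?thesis by (auto dest!: compact_imp_bounded simp: bounded_iff)
    qed
    from this[OF hol(1)] this[OF hol(2)] this[OF hol(3)] this[OF hol(4)]
    obtain B1 B2 B3 B4 where B: "\<And>z. z \<in> cball z0 1 \<Longrightarrow> norm (a z) \<le> B1"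
      "\<And>z. z \<in> cball z0 1 \<Longrightarrow> norm (b1 z) \<le> B2" "\<And>z. z \<in> cball z0 1 \<Longrightarrow> norm (b2 z) \<le> B3"
      "\<And>z. z \<in> cball z0 1 \<Longrightarrow> norm (c z) \<le> B4"
      by blast
    define R where "R = Suc (nat \<lceil>Max {B1, B2, B3, B4}\<rceil>)"
    have "Max {B1, B2, B3, B4} \<le> real R"
      unfolding R_def by linarith
    then have "B1 \<le> real R" "B2 \<le> real R" "B3 \<le> real R" "B4 \<le> real R"
      by simp_all
    then have R: "norm (a z) \<le> real R" "norm (b1 z) \<le> real R" "norm (b2 z) \<le> real R"
      "norm (c z) \<le> real R" if "z \<in> cball z0 1" for z
      using B[OF that] by linarith+
    obtain M where M: "\<And>N z. z \<in> cball z0 1 \<Longrightarrow>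
        (\<Sum>k\<le>N. norm (appell_F1_reg_term (a z) (b1 z) (b2 z) (c z) x y k (N - k))) \<le> M * majorant R q N"
      using norm_appell_F1_reg_terms_le[OF q(3,4), of R] R by metis
    have M: "norm (T N z) \<le> M * majorant R q N" if "z \<in> cball z0 1" for N z
      unfolding T_def by (rule order_trans[OF norm_sum M[OF that]])
    have "uniform_limit (cball z0 1) (\<lambda>n z. \<Sum>N<n. T N z) (\<lambda>z. \<Sum>N. T N z) sequentially"
      by (rule Weierstrass_m_test[OF M summable_mult[OF summable_majorant]])
        (use q in \<open>auto simp: R_def\<close>)
    then show "\<exists>d>0. cball z0 d \<subseteq> UNIV \<and> uniform_limit (cball z0 d) (\<lambda>n z. \<Sum>N<n. T N z)
        (\<lambda>z. appell_F1_reg (a z) (b1 z) (b2 z) (c z) x y) sequentially"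
      unfolding appell_F1_reg_def T_def by (intro exI[of _ 1]) simp
  qed simp
qed

section \<open>Analytic continuation from a real ray\<close>

lemma entire_eq_if_eq_on_real_ray:
  assumes "f holomorphic_on UNIV" "g holomorphic_on UNIV"
    and eq: "\<And>t::real. t > r \<Longrightarrow> f (of_real t) = g (of_real t)"
  shows "f z = g z"
proof -
  have "f z - g z = 0"
  proof (rule analytic_continuation[where f = "\<lambda>z. f z - g z" and S = UNIV
        and U = "complex_of_real ` {r<..}" and \<xi> = "of_real (r + 1)"])
    show "(\<lambda>z. f z - g z) holomorphic_on UNIV"
      using assms by (intro holomorphic_intros)
    show "complex_of_real (r + 1) islimpt complex_of_real ` {r<..}"
    proof (rule islimptI)
      fix T assume "complex_of_real (r + 1) \<in> T" "open T"
      then obtain e where e: "e > 0" "ball (complex_of_real (r + 1)) e \<subseteq> T"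
        by (meson openE)
      define t where "t = r + 1 + e / 2"
      have "complex_of_real t \<in> T"
        using e(1) by (intro subsetD[OF e(2)]) (simp add: t_def dist_norm norm_divide)
      moreover have "t \<noteq> r + 1" "t > r"
        using e(1) by (simp_all add: t_def)
      ultimately show "\<exists>y\<in>complex_of_real ` {r<..}. y \<in> T \<and> y \<noteq> complex_of_real (r + 1)"
        unfolding bex_simps of_real_eq_iff by blast
    qed
  qed (use eq in auto)
  then show ?thesis by simp
qed

section \<open>The multiplication formula for \<open>\<Gamma>(3z)\<close>\<close>

text \<open>
  In Euler's limit for \<open>\<Gamma>\<close>, the Pochhammer symbols of \<open>z\<close>, \<open>z + 1/3\<close>, \<open>z + 2/3\<close> at
  \<open>n\<close> multiply to that of \<open>3z\<close> at \<open>3n\<close>. Hence the quotient of the approximants does not depend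
  on \<open>z\<close>, and neither does the quotient \<open>L\<close> of the limits.
  Its value is found at \<open>z = 1/3\<close> by the reflection formula.
\<close>
lemma Gamma_triplication_real:
  fixes z :: real
  assumes z: "z > 0"
  shows "27 powr z * Gamma z * Gamma (z + 1 / 3) * Gamma (z + 2 / 3) = 2 * sqrt 3 * pi * Gamma (3 * z)"
proof -
  have poch3: "pochhammer (3 * t) (3 * n) =
      27 ^ n * (pochhammer t n * pochhammer (t + 1 / 3) n * pochhammer (t + 2 / 3) n)" for t :: real and n
    by (induction n) (simp_all add: pochhammer_Suc eval_nat_numeral field_simps)
  define h where "h = (\<lambda>n. (fact (n - 1)) ^ 3 / fact (3 * n - 1) * 27 ^ n * real n)"
  define L where "L = (\<lambda>t::real. 27 powr t * Gamma t * Gamma (t + 1 / 3) * Gamma (t + 2 / 3) / Gamma (3 * t))"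
  have lim: "h \<longlonglongrightarrow> L t" if t: "t > 0" for t :: real
  proof -
    let ?g = "\<lambda>n. 27 powr t * Gamma_series' t n * Gamma_series' (t + 1 / 3) n * Gamma_series' (t + 2 / 3) n
        / Gamma_series' (3 * t) (3 * n)"
    have pos: "Gamma (3 * t) > 0" using t by (intro Gamma_real_pos) simp
    have "(\<lambda>n. Gamma_series' (3 * t) (3 * n)) \<longlonglongrightarrow> Gamma (3 * t)"
      using LIMSEQ_subseq_LIMSEQ[OF Gamma_series'_LIMSEQ, of "(*) 3" "3 * t"]
      by (simp add: o_def strict_mono_def)
    then have "?g \<longlonglongrightarrow> L t"
      unfolding L_def using pos by (intro tendsto_intros Gamma_series'_LIMSEQ) simp_all
    moreover have "eventually (\<lambda>n. ?g n = h n) sequentially"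
      using eventually_gt_at_top[of 0]
    proof eventually_elim
      fix n :: nat assume n: "n > 0"
      have p: "pochhammer s n > 0" if "s > 0" for s :: real
        using that by (rule pochhammer_pos)
      have "exp (3 * t * ln (3 * real n)) = 27 powr t * real n powr (3 * t)"
        using n by (simp add: powr_def ln_mult exp_add ring_distribs
            powr_powr[of 3 3 t, unfolded powr_def, simplified] mult_ac ln_realpow[of 3 3, simplified])
      then have A: "Gamma_series' (3 * t) (3 * n) = fact (3 * n - 1) * (27 powr t * real n powr (3 * t)) /
          (27 ^ n * (pochhammer t n * pochhammer (t + 1 / 3) n * pochhammer (t + 2 / 3) n))"
        using n by (simp add: Gamma_series'_def poch3)
      have B: "Gamma_series' s n = fact (n - 1) * real n powr s / pochhammer s n" for s
        using n by (simp add: Gamma_series'_def powr_def)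
      have C: "real n powr (t + 1 / 3) * real n powr (t + 2 / 3) * real n powr t = real n * real n powr (3 * t)"
      proof -
        have "real n powr (t + 1 / 3) * real n powr (t + 2 / 3) * real n powr t = real n powr (1 + 3 * t)"
          by (simp add: add.commute flip: powr_add)
        then show ?thesis using n by (simp add: powr_add)
      qed
      have "?g n = (fact (n - 1)) ^ 3 / fact (3 * n - 1) * 27 ^ n *
          (real n powr (t + 1 / 3) * real n powr (t + 2 / 3) * real n powr t) / real n powr (3 * t)"
        unfolding A B using p[of t] p[of "t + 1 / 3"] p[of "t + 2 / 3"] t
        by (simp add: field_simps power3_eq_cube)
      then show "?g n = h n"
        unfolding C h_def using n by simp
    qed
    ultimately show ?thesis by (rule Lim_transform_eventually)
  qed
  have "L z = L (1 / 3)"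
    by (rule LIMSEQ_unique[OF lim lim]) (use z in auto)
  also have "L (1 / 3) = 3 * (Gamma (1 / 3) * Gamma (2 / 3))"
  proof -
    have "(27 :: real) powr (1 / 3) = 3"
      using powr_powr[of "3::real" 3 "1 / 3"] by simp
    then show ?thesis by (simp add: L_def)
  qed
  also have "Gamma (1 / 3 :: real) * Gamma (2 / 3) = 2 * pi / sqrt 3"
  proof -
    have "complex_of_real (Gamma (1 / 3) * Gamma (2 / 3)) = Gamma (1 / 3) * Gamma (1 - 1 / 3)"
      by (simp flip: Gamma_complex_of_real)
    also have "\<dots> = of_real pi / sin (of_real (pi / 3))"
      by (subst Gamma_reflection_complex) simp
    also have "\<dots> = complex_of_real (pi / sin (pi / 3))"
      by (simp only: of_real_divide[of pi "sin (pi / 3)"] sin_of_real)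
    also have "pi / sin (pi / 3) = 2 * pi / sqrt 3"
      by (simp add: sin_60)
    finally show ?thesis unfolding of_real_eq_iff .
  qed
  also have "3 * (2 * pi / sqrt 3) = 2 * sqrt 3 * pi"
    by (simp add: field_simps)
  finally have "L z = 2 * sqrt 3 * pi" .
  moreover have "Gamma (3 * z) > 0"
    using z by (intro Gamma_real_pos) simp
  then have "27 powr z * Gamma z * Gamma (z + 1 / 3) * Gamma (z + 2 / 3) = L z * Gamma (3 * z)"
    by (simp add: L_def)
  ultimately show ?thesis by simp
qed

section \<open>Euler's integral\<close>

lemma binomial_prod_coeff_sums:
  fixes b1 b2 x y t :: real
  assumes "0 \<le> x" "x < 1" "0 \<le> y" "y < 1" "0 \<le> t" "t \<le> 1"
  shows "(\<lambda>N. binomial_prod_coeff b1 b2 x y N * t ^ N) sums ((1 - x * t) powr - b1 * (1 - y * t) powr - b2)"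
proof -
  have S: "(\<lambda>n. pochhammer b n / fact n * (u * t) ^ n) sums ((1 - u * t) powr - b)"
    and N: "summable (\<lambda>n. norm (pochhammer b n / fact n * (u * t) ^ n))"
    if u: "0 \<le> u" "u < 1" for b u
  proof -
    have ut: "u * t < 1"
      using u assms(5,6) by (metis mult_left_le order_le_less_trans)
    have "(\<lambda>n. ((- b) gchoose n) * (- (u * t)) ^ n) sums (1 + (- (u * t))) powr - b"
      using ut u assms(5) by (intro gen_binomial_real) (simp add: abs_mult)
    moreover have "((- b) gchoose n) * (- (u * t)) ^ n = pochhammer b n / fact n * (u * t) ^ n" for n
      by (cases "even n") (simp_all add: gbinomial_pochhammer)
    ultimately show "(\<lambda>n. pochhammer b n / fact n * (u * t) ^ n) sums ((1 - u * t) powr - b)"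
      by simp
    define q where "q = max (1 / 2) (u * t)"
    define R where "R = \<bar>b\<bar> + 1"
    show "summable (\<lambda>n. norm (pochhammer b n / fact n * (u * t) ^ n))"
    proof (rule summable_comparison_test'[OF summable_binomial_majorant[of R q], of 0])
      fix n :: nat
      have norm_idem: "norm (norm z) = norm z" for z :: real by simp
      have "norm (pochhammer b n) \<le> pochhammer R n"
        by (rule norm_pochhammer_le) (simp add: R_def)
      then show "norm (norm (pochhammer b n / fact n * (u * t) ^ n)) \<le> pochhammer R n / fact n * q ^ n"
        unfolding norm_idem norm_mult norm_divide norm_power norm_fact using u assms(5)
        by (intro mult_mono divide_right_mono power_mono) (auto simp: q_def R_def pochhammer_ge_0 abs_mult)
    qed (use ut in \<open>auto simp: q_def R_def\<close>)
  qed
  have "(\<lambda>N. \<Sum>k\<le>N. (pochhammer b1 k / fact k * (x * t) ^ k) *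
      (pochhammer b2 (N - k) / fact (N - k) * (y * t) ^ (N - k))) sums
      ((1 - x * t) powr - b1 * (1 - y * t) powr - b2)"
    using Cauchy_product_sums[OF N[OF assms(1,2), of b1] N[OF assms(3,4), of b2]]
      S[OF assms(1,2), of b1] S[OF assms(3,4), of b2] by (simp add: sums_iff)
  moreover have "(\<Sum>k\<le>N. (pochhammer b1 k / fact k * (x * t) ^ k) *
      (pochhammer b2 (N - k) / fact (N - k) * (y * t) ^ (N - k))) = binomial_prod_coeff b1 b2 x y N * t ^ N" for N
    unfolding binomial_prod_coeff_def sum_distrib_right
  proof (intro sum.cong refl)
    fix k assume "k \<in> {..N}"
    then have "t ^ N = t ^ (k + (N - k))" by simp
    also have "\<dots> = t ^ k * t ^ (N - k)" by (rule power_add)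
    finally have tN: "t ^ N = t ^ k * t ^ (N - k)" .
    show "(pochhammer b1 k / fact k * (x * t) ^ k) * (pochhammer b2 (N - k) / fact (N - k) * (y * t) ^ (N - k))
      = (pochhammer b1 k / fact k * x ^ k) * (pochhammer b2 (N - k) / fact (N - k) * y ^ (N - k)) * t ^ N"
      unfolding tN power_mult_distrib by simp
  qed
  ultimately show ?thesis by simp
qed

text \<open>
  Expanding the two binomials and integrating termwise yields Beta integrals. Since \<open>1 < a\<close>
  and \<open>1 < c - a\<close>, the weight is continuous and bounded by \<open>1\<close> on the closed interval, so
  uniform convergence of the binomial series allows sum and integral to be interchanged.
\<close>
lemma appell_F1_reg_Euler_integral:
  fixes a b1 b2 c x y :: real
  assumes a: "1 < a" and ca: "1 < c - a" and xy: "0 \<le> x" "x < 1" "0 \<le> y" "y < 1"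
  shows "((\<lambda>t. t powr (a - 1) * (1 - t) powr (c - a - 1) * ((1 - x * t) powr - b1 * (1 - y * t) powr - b2))
     has_integral (Gamma a * Gamma (c - a) * appell_F1_reg a b1 b2 c x y)) {0..1}" (is ?int)
    and "summable (\<lambda>N. \<Sum>k\<le>N. appell_F1_reg_term a b1 b2 c x y k (N - k))" (is ?sm)
proof -
  have Gamma_pos: "Gamma a > 0" "Gamma (c - a) > 0"
    using a ca by (intro Gamma_real_pos; simp)+
  define w where "w = (\<lambda>t::real. t powr (a - 1) * (1 - t) powr (c - a - 1))"
  define C where "C = binomial_prod_coeff b1 b2 x y"
  define P where "P = (\<lambda>t. (1 - x * t) powr - b1 * (1 - y * t) powr - b2)"
  define q where "q = max (1 / 2) (max x y)"
  define R where "R = \<bar>b1\<bar> + \<bar>b2\<bar> + 1"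
  have w_cont: "continuous_on {0..1} w"
    unfolding w_def using a ca by (intro continuous_intros continuous_on_powr') auto
  have w01: "\<bar>w t\<bar> \<le> 1" if "t \<in> {0..1}" for t
    unfolding w_def abs_mult using that a ca by (intro mult_le_one) (auto intro!: powr_le1)
  have uni: "uniform_limit {0..1} (\<lambda>n t. \<Sum>N<n. w t * (C N * t ^ N)) (\<lambda>t. \<Sum>N. w t * (C N * t ^ N)) sequentially"
  proof (rule Weierstrass_m_test)
    show "summable (\<lambda>N. pochhammer (2 * R) N / fact N * q ^ N)"
      using xy by (intro summable_binomial_majorant) (auto simp: R_def q_def)
    fix N :: nat and t :: real assume t: "t \<in> {0..1}"
    have "norm (C N) \<le> pochhammer (2 * R) N / fact N * q ^ N"
      unfolding C_def by (rule norm_binomial_prod_coeff_le) (use xy in \<open>auto simp: R_def q_def\<close>)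
    moreover have "norm (w t * (C N * t ^ N)) \<le> 1 * (norm (C N) * 1)"
      unfolding norm_mult using w01[OF t] t
      by (intro mult_mono) (auto simp: power_le_one)
    ultimately show "norm (w t * (C N * t ^ N)) \<le> pochhammer (2 * R) N / fact N * q ^ N"
      by simp
  qed
  have sum: "(\<Sum>N. w t * (C N * t ^ N)) = w t * P t" if "t \<in> {0..1}" for t
    using sums_mult[OF binomial_prod_coeff_sums[OF xy, of t b1 b2], of "w t"] that
    by (simp add: sums_iff C_def P_def)
  have uni': "uniform_limit {0..1} (\<lambda>n t. \<Sum>N<n. w t * (C N * t ^ N)) (\<lambda>t. w t * P t) sequentially"
    by (rule uniform_limit_cong'[THEN iffD1, OF _ _ uni]) (simp_all add: sum)
  have cont: "continuous_on {0..1} (\<lambda>t. \<Sum>N<n. w t * (C N * t ^ N))" for n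
    by (intro continuous_intros w_cont)
  have int: "((\<lambda>t. w t * (C N * t ^ N)) has_integral (C N * Beta (a + N) (c - a))) {0..1}" for N
  proof -
    have "((\<lambda>t. C N * (t powr (a + N - 1) * (1 - t) powr (c - a - 1))) has_integral
        (C N * Beta (a + N) (c - a))) {0..1}"
      using a ca by (intro has_integral_mult_right has_integral_Beta_real) auto
    moreover have "C N * (t powr (a + N - 1) * (1 - t) powr (c - a - 1)) = w t * (C N * t ^ N)"
      if "t \<in> {0..1}" for t
    proof (cases "t = 0")
      case False
      have "t powr (a + N - 1) = t powr ((a - 1) + real N)"
        by (simp add: algebra_simps)
      also have "\<dots> = t powr (a - 1) * t ^ N"
        using False that powr_realpow[of t N] by (simp add: powr_add)
      finally have "t powr (a + N - 1) = t powr (a - 1) * t ^ N" .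
      then show ?thesis by (simp add: w_def)
    qed (use a in \<open>simp add: w_def\<close>)
    ultimately show ?thesis by (rule has_integral_eq[rotated]) 
  qed
  obtain I J where IJ: "\<And>n. ((\<lambda>t. \<Sum>N<n. w t * (C N * t ^ N)) has_integral I n) {0..1}"
    "((\<lambda>t. w t * P t) has_integral J) {0..1}" "I \<longlonglongrightarrow> J"
    by (rule uniform_limit_integral[OF uni' cont]) auto
  have I: "I = (\<lambda>n. \<Sum>N<n. C N * Beta (a + N) (c - a))"
    by (rule ext, rule has_integral_unique[OF IJ(1)]) (intro has_integral_sum int, simp)
  have "(\<lambda>N. C N * Beta (a + N) (c - a)) sums J"
    using IJ(3) unfolding I sums_def .
  moreover have "C N * Beta (a + N) (c - a) =
      Gamma a * Gamma (c - a) * (\<Sum>k\<le>N. appell_F1_reg_term a b1 b2 c x y k (N - k))" for N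
  proof -
    have "a \<notin> \<int>\<^sub>\<le>\<^sub>0" using a by (auto elim!: nonpos_Ints_cases)
    then have "Gamma (a + N) = Gamma a * pochhammer a N"
      using pochhammer_Gamma[of a N] Gamma_pos by simp
    then show ?thesis
      unfolding sum_appell_F1_reg_term C_def Beta_altdef by (simp add: add.commute)
  qed
  ultimately have "(\<lambda>N. Gamma a * Gamma (c - a) * (\<Sum>k\<le>N. appell_F1_reg_term a b1 b2 c x y k (N - k))) sums J"
    by simp
  from sums_divide[OF this, of "Gamma a * Gamma (c - a)"]
  have *: "(\<lambda>N. \<Sum>k\<le>N. appell_F1_reg_term a b1 b2 c x y k (N - k)) sums (J / (Gamma a * Gamma (c - a)))"
    using Gamma_pos by simp
  then show ?sm by (simp add: sums_iff)
  from * have "appell_F1_reg a b1 b2 c x y = J / (Gamma a * Gamma (c - a))"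
    by (simp add: appell_F1_reg_def sums_iff)
  then have "J = Gamma a * Gamma (c - a) * appell_F1_reg a b1 b2 c x y"
    using Gamma_pos by simp
  with IJ(2) show ?int by (simp add: w_def P_def)
qed

lemma appell_F1_reg_of_real:
  assumes "summable (\<lambda>N. \<Sum>k\<le>N. appell_F1_reg_term a b1 b2 c x y k (N - k))"
  shows "appell_F1_reg (complex_of_real a) (of_real b1) (of_real b2) (of_real c) (of_real x) (of_real y)
    = of_real (appell_F1_reg a b1 b2 c x y)"
proof -
  have "rGamma (complex_of_real c + of_nat n) = of_real (rGamma (c + real n))" for n
    using rGamma_complex_of_real[of "c + real n"] by simp
  then have "appell_F1_reg_term (complex_of_real a) (of_real b1) (of_real b2) (of_real c) (of_real x) (of_real y) m n
      = of_real (appell_F1_reg_term a b1 b2 c x y m n)" for m n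
    unfolding appell_F1_reg_term_def by (simp add: pochhammer_of_real del: of_nat_add)
  then show ?thesis
    unfolding appell_F1_reg_def using suminf_of_real[OF assms, where ?'a = complex] by simp
qed

section \<open>The cubic substitution\<close>

text \<open>
  The right-hand side is the Beta integral \<open>\<integral> s^(\<alpha> - 1) (1 - s)^(\<beta> - \<alpha> - 1) ds\<close> after the substitution
  \<open>s = t^3 / (4 - 3t)^2\<close>. The constant comes from normalising \<open>4 - 3t\<close> and \<open>4 - t\<close> to
  \<open>1 - 3t/4\<close> and \<open>1 - t/4\<close>: their exponents add up to \<open>-2\<alpha>\<close>, and the
  \<open>3\<close> is the one in \<open>ds/dt\<close>.
\<close>
lemma cubic_substitution_integral:
  fixes \<alpha> \<beta> :: real
  assumes \<alpha>: "1 < \<alpha>" and \<beta>: "1 < \<beta> - \<alpha>"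
  shows "((\<lambda>t. t powr (3 * \<alpha> - 1) * (1 - t) powr (\<beta> - \<alpha> - 1) *
      ((1 - 3 / 4 * t) powr (1 - 2 * \<beta>) * (1 - 1 / 4 * t) powr (2 * \<beta> - 2 * \<alpha> - 1)))
     has_integral (16 powr \<alpha> / 3 * Beta \<alpha> (\<beta> - \<alpha>))) {0..1}"
proof -
  define g where "g = (\<lambda>t::real. t ^ 3 / (4 - 3 * t) ^ 2)"
  define g' where "g' = (\<lambda>t::real. 3 * t ^ 2 * (4 - t) / (4 - 3 * t) ^ 3)"
  define F where "F = (\<lambda>s::real. s powr (\<alpha> - 1) * (1 - s) powr (\<beta> - \<alpha> - 1))"
  have one_minus_g: "1 - g t = (1 - t) * (4 - t) ^ 2 / (4 - 3 * t) ^ 2" if "t \<le> 1" for t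
  proof -
    have "4 - 3 * t \<noteq> 0" using that by simp
    then show ?thesis unfolding g_def by (simp add: divide_simps) (simp add: power2_eq_square power3_eq_cube algebra_simps)
  qed
  have "((\<lambda>t. g' t *\<^sub>R F (g t)) has_integral (integral {g 0..g 1} F)) {0..1}"
  proof (rule has_integral_substitution[where c = 0 and d = 1])
    show "g ` {0..1} \<subseteq> {0..1}"
    proof safe
      fix t :: real assume t: "t \<in> {0..1}"
      have "0 \<le> 1 - g t" using t by (subst one_minus_g) auto
      moreover have "0 \<le> g t" using t by (simp add: g_def)
      ultimately show "g t \<in> {0..1}" by simp
    qed
    show "continuous_on {0..1} F"
      unfolding F_def using \<alpha> \<beta> by (intro continuous_intros continuous_on_powr') auto
    fix t :: real assume t: "t \<in> {0..1}"
    then have nz: "4 - 3 * t \<noteq> 0" by simp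
    have "(g has_real_derivative (3 * t ^ 2 * (4 - 3 * t) ^ 2 + 6 * t ^ 3 * (4 - 3 * t)) /
        ((4 - 3 * t) ^ 2 * (4 - 3 * t) ^ 2)) (at t within {0..1})"
      unfolding g_def using nz by (auto intro!: derivative_eq_intros simp: algebra_simps)
    moreover have "(3 * t ^ 2 * u ^ 2 + 6 * t ^ 3 * u) / (u ^ 2 * u ^ 2) = 3 * t ^ 2 * (u + 2 * t) / u ^ 3"
      if "u \<noteq> 0" for u
      using that by (simp add: divide_simps) (simp add: power2_eq_square power3_eq_cube power4_eq_xxxx algebra_simps)
    ultimately show "(g has_real_derivative g' t) (at t within {0..1})"
      using nz by (simp add: g'_def)
  qed (auto simp: g_def)
  moreover have "integral {g 0..g 1} F = Beta \<alpha> (\<beta> - \<alpha>)"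
    unfolding F_def g_def using \<alpha> \<beta> has_integral_Beta_real[of \<alpha> "\<beta> - \<alpha>"] 
    by (auto dest: integral_unique)
  ultimately have "((\<lambda>t. g' t * F (g t)) has_integral Beta \<alpha> (\<beta> - \<alpha>)) {0<..<1}"
    by (simp add: has_integral_Icc_iff_Ioo)
  then have I: "((\<lambda>t. 16 powr \<alpha> / 3 * (g' t * F (g t))) has_integral (16 powr \<alpha> / 3 * Beta \<alpha> (\<beta> - \<alpha>))) {0<..<1}"
    by (rule has_integral_mult_right)
  have "16 powr \<alpha> / 3 * (g' t * F (g t)) = t powr (3 * \<alpha> - 1) * (1 - t) powr (\<beta> - \<alpha> - 1) *
      ((1 - 3 / 4 * t) powr (1 - 2 * \<beta>) * (1 - 1 / 4 * t) powr (2 * \<beta> - 2 * \<alpha> - 1))"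
    if t: "t \<in> {0<..<1}" for t
  proof -
    \<comment> \<open>In the logarithms of the linear forms the identity of the two integrands is linear in the exponents.\<close>
    define T where "T = ln t"
    define p where "p = ln (1 - t)"
    define u where "u = ln (4 - 3 * t)"
    define v where "v = ln (4 - t)"
    define f where "f = ln (4 :: real)"
    have e: "t = exp T" "1 - t = exp p" "4 - 3 * t = exp u" "4 - t = exp v" "4 = exp f"
      using t by (simp_all add: T_def p_def u_def v_def f_def)
    have sq: "exp s ^ 2 = exp (2 * s)" "exp s ^ 3 = exp (3 * s)" for s :: real
      by (simp_all add: exp_double exp_of_nat_mult[of 3, simplified])
    have G1: "g t = exp (3 * T - 2 * u)"
      unfolding g_def e(3) sq by (simp add: e(1) sq exp_diff)
    have G2: "1 - g t = exp (p + 2 * v - 2 * u)"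
      using t by (subst one_minus_g) (simp_all only: e(2-4) sq exp_diff exp_add, simp)
    have G3: "g' t = 3 * exp (2 * T + v - 3 * u)"
      unfolding g'_def e(3,4) sq by (simp add: e(1) sq exp_diff exp_add)
    have L: "g' t * F (g t) = 3 * exp ((2 * T + v - 3 * u) + (\<alpha> - 1) * (3 * T - 2 * u)
        + (\<beta> - \<alpha> - 1) * (p + 2 * v - 2 * u))"
      unfolding F_def G2 unfolding G1 G3 by (simp add: powr_def exp_add)
    have "1 - 3 / 4 * t = (4 - 3 * t) / 4" "1 - 1 / 4 * t = (4 - t) / 4" by simp_all
    then have "1 - 3 / 4 * t = exp (u - f)" "1 - 1 / 4 * t = exp (v - f)"
      using e(3-5) by (simp_all only: exp_diff)
    then have R: "t powr (3 * \<alpha> - 1) * (1 - t) powr (\<beta> - \<alpha> - 1) *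
      ((1 - 3 / 4 * t) powr (1 - 2 * \<beta>) * (1 - 1 / 4 * t) powr (2 * \<beta> - 2 * \<alpha> - 1))
      = exp ((3 * \<alpha> - 1) * T + (\<beta> - \<alpha> - 1) * p + ((1 - 2 * \<beta>) * (u - f) + (2 * \<beta> - 2 * \<alpha> - 1) * (v - f)))"
      using t by (simp add: powr_def exp_add T_def p_def)
    have "16 powr \<alpha> = exp (2 * f * \<alpha>)"
      using ln_realpow[of "4::real" 2] by (simp add: powr_def f_def)
    then show ?thesis
      unfolding L R by (simp add: algebra_simps flip: exp_add)
  qed
  with I show ?thesis
    unfolding has_integral_Icc_iff_Ioo by (rule has_integral_eq[rotated]) 
qed


section \<open>The evaluation\<close>

lemma appell_F1_reg_cubic_real:
  fixes \<alpha> \<beta> :: real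
  assumes \<alpha>: "1 < \<alpha>" and \<beta>: "1 < \<beta> - \<alpha>"
  shows "appell_F1_reg (complex_of_real (3 * \<alpha>)) (of_real (2 * \<beta> - 1)) (of_real (2 * \<alpha> + 1 - 2 * \<beta>))
      (of_real (2 * \<alpha> + \<beta>)) (of_real (3 / 4)) (of_real (1 / 4))
    = of_real (2 powr (4 * \<alpha> + 1) * pi / 3 powr (3 * \<alpha> + 1 / 2)
        * rGamma (\<alpha> + 1 / 3) * rGamma (\<alpha> + 2 / 3) * rGamma \<beta>)"
proof -
  let ?F = "appell_F1_reg (3 * \<alpha>) (2 * \<beta> - 1) (2 * \<alpha> + 1 - 2 * \<beta>) (2 * \<alpha> + \<beta>) (3 / 4) (1 / 4)"
  have pos: "Gamma (\<beta> - \<alpha>) > 0" "Gamma (3 * \<alpha>) > 0" "Gamma (\<alpha> + 1 / 3) > 0" "Gamma (\<alpha> + 2 / 3) > 0"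
    using \<alpha> \<beta> by (intro Gamma_real_pos; simp)+
  have "((\<lambda>t. t powr (3 * \<alpha> - 1) * (1 - t) powr ((2 * \<alpha> + \<beta>) - 3 * \<alpha> - 1) *
      ((1 - 3 / 4 * t) powr - (2 * \<beta> - 1) * (1 - 1 / 4 * t) powr - (2 * \<alpha> + 1 - 2 * \<beta>)))
     has_integral (Gamma (3 * \<alpha>) * Gamma ((2 * \<alpha> + \<beta>) - 3 * \<alpha>) * ?F)) {0..1}"
    and sm: "summable (\<lambda>N. \<Sum>k\<le>N. appell_F1_reg_term (3 * \<alpha>) (2 * \<beta> - 1) (2 * \<alpha> + 1 - 2 * \<beta>)
      (2 * \<alpha> + \<beta>) (3 / 4) (1 / 4) k (N - k))"
    using \<alpha> \<beta> by (intro appell_F1_reg_Euler_integral; simp)+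
  moreover have e: "(2 * \<alpha> + \<beta>) - 3 * \<alpha> = \<beta> - \<alpha>" "- (2 * \<beta> - 1) = 1 - 2 * \<beta>"
    "- (2 * \<alpha> + 1 - 2 * \<beta>) = 2 * \<beta> - 2 * \<alpha> - 1" by simp_all
  ultimately have "Gamma (3 * \<alpha>) * Gamma (\<beta> - \<alpha>) * ?F = 16 powr \<alpha> / 3 * Beta \<alpha> (\<beta> - \<alpha>)"
    unfolding e by (intro has_integral_unique[OF _ cubic_substitution_integral[OF assms]])
  also have "\<dots> = 16 powr \<alpha> / 3 * Gamma \<alpha> * Gamma (\<beta> - \<alpha>) * rGamma \<beta>"
    by (simp add: Beta_altdef)
  finally have "Gamma (3 * \<alpha>) * ?F = 16 powr \<alpha> / 3 * Gamma \<alpha> * rGamma \<beta>"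
    using pos(1) by simp
  then have F: "?F = 16 powr \<alpha> / 3 * (Gamma \<alpha> / Gamma (3 * \<alpha>)) * rGamma \<beta>"
    using pos(2) by (simp add: field_simps)
  have alg: "A / D = k / w * (inverse B * inverse C)"
    if "w * A * B * C = k * D" "w > 0" "B > 0" "C > 0" "D > 0" for A B C D k w :: real
    using that by (simp add: divide_simps mult_ac)
  have ratio: "Gamma \<alpha> / Gamma (3 * \<alpha>) = 2 * sqrt 3 * pi / 27 powr \<alpha> * (rGamma (\<alpha> + 1 / 3) * rGamma (\<alpha> + 2 / 3))"
    unfolding rGamma_inverse_Gamma by (rule alg[OF Gamma_triplication_real]) (use pos \<alpha> in auto)
  have "(16 :: real) powr \<alpha> = 2 powr (4 * \<alpha>)" "(27 :: real) powr \<alpha> = 3 powr (3 * \<alpha>)"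
    using powr_powr[of "2::real" 4 \<alpha>] powr_powr[of "3::real" 3 \<alpha>] by simp_all
  moreover have "(2 :: real) powr (4 * \<alpha> + 1) = 2 * 2 powr (4 * \<alpha>)"
      "(3 :: real) powr (3 * \<alpha> + 1 / 2) = 3 powr (3 * \<alpha>) * sqrt 3"
    by (simp_all add: powr_add powr_half_sqrt)
  ultimately have const: "16 powr \<alpha> / 3 * (2 * sqrt 3 * pi / 27 powr \<alpha>) = 2 powr (4 * \<alpha> + 1) * pi / 3 powr (3 * \<alpha> + 1 / 2)"
    by (simp add: field_simps)
  have "?F = (16 powr \<alpha> / 3 * (2 * sqrt 3 * pi / 27 powr \<alpha>))
        * rGamma (\<alpha> + 1 / 3) * rGamma (\<alpha> + 2 / 3) * rGamma \<beta>"
    unfolding F ratio by simp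
  then have "?F = 2 powr (4 * \<alpha> + 1) * pi / 3 powr (3 * \<alpha> + 1 / 2)
        * rGamma (\<alpha> + 1 / 3) * rGamma (\<alpha> + 2 / 3) * rGamma \<beta>"
    unfolding const .
  then show ?thesis
    using appell_F1_reg_of_real[OF sm] by simp
qed

text \<open>
  Both sides are entire in \<open>\<beta>\<close> for fixed \<open>\<alpha>\<close> and vice versa. For fixed real
  \<open>\<alpha> > 1\<close> they agree for all real \<open>\<beta> > \<alpha> + 1\<close>, hence for all
  \<open>\<beta>\<close>; then for fixed \<open>\<beta>\<close> they agree for all real \<open>\<alpha> > 1\<close>, hence everywhere.
\<close>
lemma appell_F1_reg_cubic:
  fixes \<alpha> \<beta> :: complex
  shows "appell_F1_reg (3 * \<alpha>) (2 * \<beta> - 1) (2 * \<alpha> + 1 - 2 * \<beta>) (2 * \<alpha> + \<beta>) (3 / 4) (1 / 4)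
    = 2 powr (4 * \<alpha> + 1) * of_real pi / 3 powr (3 * \<alpha> + 1 / 2)
        * rGamma (\<alpha> + 1 / 3) * rGamma (\<alpha> + 2 / 3) * rGamma \<beta>"
proof -
  define L where "L = (\<lambda>\<alpha> \<beta>. appell_F1_reg (3 * \<alpha>) (2 * \<beta> - 1) (2 * \<alpha> + 1 - 2 * \<beta>) (2 * \<alpha> + \<beta>) (3 / 4) (1 / 4 :: complex))"
  define H where "H = (\<lambda>\<alpha> \<beta>. 2 powr (4 * \<alpha> + 1) * of_real pi / 3 powr (3 * \<alpha> + 1 / 2)
        * rGamma (\<alpha> + 1 / 3) * rGamma (\<alpha> + 2 / 3) * rGamma (\<beta> :: complex))"
  have holL: "(\<lambda>\<beta>. L \<alpha> \<beta>) holomorphic_on UNIV" "(\<lambda>\<alpha>. L \<alpha> \<beta>) holomorphic_on UNIV" for \<alpha> \<beta>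
    unfolding L_def by (intro holomorphic_appell_F1_reg holomorphic_intros; simp)+
  have holH: "(\<lambda>\<beta>. H \<alpha> \<beta>) holomorphic_on UNIV" "(\<lambda>\<alpha>. H \<alpha> \<beta>) holomorphic_on UNIV" for \<alpha> \<beta>
    unfolding H_def by (intro holomorphic_intros; simp)+
  have real: "L (of_real a) (of_real b) = H (of_real a) (of_real b)" if "1 < a" "1 < b - a" for a b
  proof -
    have P: "complex_of_real x powr of_real y = of_real (x powr y)" if "x \<ge> 0" for x y
      using that by (simp add: powr_of_real)
    have "H (of_real a) (of_real b) = of_real (2 powr (4 * a + 1) * pi / 3 powr (3 * a + 1 / 2)
        * rGamma (a + 1 / 3) * rGamma (a + 2 / 3) * rGamma b)"
      unfolding H_def using P[of 2 "4 * a + 1"] P[of 3 "3 * a + 1 / 2"]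
        rGamma_complex_of_real[of "a + 1 / 3"] rGamma_complex_of_real[of "a + 2 / 3"] rGamma_complex_of_real[of b]
      by simp
    then show ?thesis
      using appell_F1_reg_cubic_real[OF that] by (simp add: L_def)
  qed
  have ray: "L (of_real a) \<beta> = H (of_real a) \<beta>" if "1 < a" for a \<beta>
    by (rule entire_eq_if_eq_on_real_ray[OF holL(1) holH(1), of "a + 1"]) (use that in \<open>auto intro!: real\<close>)
  have "L \<alpha> \<beta> = H \<alpha> \<beta>"
    by (rule entire_eq_if_eq_on_real_ray[OF holL(2) holH(2) ray])
  then show ?thesis by (simp add: L_def H_def)
qed

theorem mainTheorem5:
  fixes \<alpha> \<beta> :: complex
  assumes "2 * \<alpha> + \<beta> \<notin> \<int>\<^sub>\<le>\<^sub>0"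
  shows "appell_F1 (3 * \<alpha>) (2 * \<beta> - 1) (2 * \<alpha> + 1 - 2 * \<beta>) (2 * \<alpha> + \<beta>) (3 / 4) (1 / 4)
    = 2 powr (4 * \<alpha> + 1) * of_real pi * Gamma (2 * \<alpha> + \<beta>) / 3 powr (3 * \<alpha> + 1 / 2)
        * rGamma (\<alpha> + 1 / 3) * rGamma (\<alpha> + 2 / 3) * rGamma \<beta>"
  by (subst appell_F1_eq_Gamma_times_reg[OF assms]) (simp_all add: appell_F1_reg_cubic)

end
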